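(* Let $n>1$ be an odd integer. Then $G_n^\star$ is cyclic if and only if either $n=p^\alpha$, or $n=p^\alpha q^\beta$ with $\gcd\big(\varphi(p^\alpha),\varphi(q^\beta)\big)=2$, where $p,q$ are distinct odd primes and $\alpha,\beta$ are positive integers.
   Context: For a positive integer $n$ and integers $a,b$ coprime to $n$, write $a\equiv b\ (\mathrm{mod}^\star\, n)$ if $a-b\in n\mathbb{Z}$ or $a+b\in n\mathbb{Z}$. $G_n^\star$ denotes the group of equivalence classes of integers coprime to $n$ under this relation, with multiplication $[a][b]=[ab]$ (equivalently $G_n^\star\cong(\mathbb{Z}/n\mathbb{Z})^\times/\langle -1\rangle$). $\varphi$ is Euler's totient function. *)

theory Defs
  imports "HOL-Algebra.Elementary_Groups" "HOL-Number_Theory.Totient"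
begin

definition coprime_ints :: "nat \<Rightarrow> int set" where
  "coprime_ints n = {a. coprime a (int n)}"

definition mod_star :: "nat \<Rightarrow> (int \<times> int) set" where
  "mod_star n = {(a, b). a \<in> coprime_ints n \<and> b \<in> coprime_ints n \<and>
                         (int n dvd a - b \<or> int n dvd a + b)}"

text \<open>
  The product of two classes is the class of the product of representatives; the union over all
  representatives is harmless because they all yield the same class, see \<open>G_star_mult_class\<close>.
\<close>

definition G_star :: "nat \<Rightarrow> int set monoid" where
  "G_star n =
     \<lparr>carrier = coprime_ints n // mod_star n,
      monoid.mult = (\<lambda>X Y. \<Union>a\<in>X. \<Union>b\<in>Y. mod_star n `` {a * b}),
      one = mod_star n `` {1}\<rparr>"

lemma coprime_ints_mult:
  "a \<in> coprime_ints n \<Longrightarrow> b \<in> coprime_ints n \<Longrightarrow> a * b \<in> coprime_ints n"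
  by (simp add: coprime_ints_def)

lemma coprime_ints_1: "1 \<in> coprime_ints n"
  by (simp add: coprime_ints_def)

lemma mod_star_iff:
  "(a, b) \<in> mod_star n \<longleftrightarrow> a \<in> coprime_ints n \<and> b \<in> coprime_ints n \<and>
     (\<exists>s\<in>{1, -1}. int n dvd a - s * b)"
  by (auto simp: mod_star_def)

lemma equiv_mod_star: "equiv (coprime_ints n) (mod_star n)"
proof (rule equivI)
  show "mod_star n \<subseteq> coprime_ints n \<times> coprime_ints n"
    by (auto simp: mod_star_def)
  show "refl_on (coprime_ints n) (mod_star n)"
    by (auto simp: refl_on_def mod_star_def)
  show "sym (mod_star n)"
  proof (rule symI)
    fix a b assume "(a, b) \<in> mod_star n"
    thus "(b, a) \<in> mod_star n"
      using dvd_diff_commute[of "int n" a b] add.commute[of a b]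
      unfolding mod_star_def by auto
  qed
  show "trans (mod_star n)"
  proof (rule transI)
    fix a b c assume ab: "(a, b) \<in> mod_star n" and bc: "(b, c) \<in> mod_star n"
    from ab bc obtain s t where st: "s \<in> {1, -1 :: int}" "t \<in> {1, -1 :: int}"
      "int n dvd a - s * b" "int n dvd b - t * c"
      unfolding mod_star_iff by blast
    have "int n dvd (a - s * b) + s * (b - t * c)"
      using st by (intro dvd_add dvd_mult)
    hence "int n dvd a - (s * t) * c"
      by (simp add: algebra_simps)
    moreover have "s * t \<in> {1, -1}"
      using st by auto
    ultimately show "(a, c) \<in> mod_star n"
      using ab bc unfolding mod_star_iff by blast
  qed
qed

lemma mod_star_mult:
  assumes "(a, a') \<in> mod_star n" "(b, b') \<in> mod_star n"
  shows   "(a * b, a' * b') \<in> mod_star n"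
proof -
  from assms obtain s t where st: "s \<in> {1, -1 :: int}" "t \<in> {1, -1 :: int}"
    "int n dvd a - s * a'" "int n dvd b - t * b'"
    unfolding mod_star_iff by blast
  have "int n dvd (a - s * a') * b + s * a' * (b - t * b')"
    using st by (intro dvd_add dvd_mult dvd_mult2)
  hence "int n dvd a * b - (s * t) * (a' * b')"
    by (simp add: algebra_simps)
  moreover have "s * t \<in> {1, -1}"
    using st by auto
  ultimately show ?thesis
    using assms coprime_ints_mult unfolding mod_star_iff by blast
qed

lemma G_star_mult_class:
  assumes "a \<in> coprime_ints n" "b \<in> coprime_ints n"
  shows   "mod_star n `` {a} \<otimes>\<^bsub>G_star n\<^esub> mod_star n `` {b} = mod_star n `` {a * b}"
proof -
  have "mod_star n `` {a' * b'} = mod_star n `` {a * b}"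
    if "(a, a') \<in> mod_star n" "(b, b') \<in> mod_star n" for a' b'
    using mod_star_mult[OF that] equiv_class_eq[OF equiv_mod_star] by metis
  moreover have "(a, a) \<in> mod_star n" "(b, b) \<in> mod_star n"
    using assms by (auto simp: mod_star_def)
  ultimately have "(\<Union>a'\<in>mod_star n `` {a}. \<Union>b'\<in>mod_star n `` {b}. mod_star n `` {a' * b'}) =
      mod_star n `` {a * b}"
    by blast
  thus ?thesis
    by (simp add: G_star_def)
qed

lemma comm_group_G_star: "comm_group (G_star n)"
proof (rule comm_groupI)
  let ?c = "\<lambda>a. mod_star n `` {a}"
  have carr: "carrier (G_star n) = ?c ` coprime_ints n"
    by (auto simp: G_star_def quotient_def)
  have one: "\<one>\<^bsub>G_star n\<^esub> = ?c 1"
    by (simp add: G_star_def)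
  note simps = carr one G_star_mult_class coprime_ints_mult coprime_ints_1
  fix x assume x: "x \<in> carrier (G_star n)"
  show "\<one>\<^bsub>G_star n\<^esub> \<otimes>\<^bsub>G_star n\<^esub> x = x"
    using x by (auto simp: simps)
  show "\<exists>y\<in>carrier (G_star n). y \<otimes>\<^bsub>G_star n\<^esub> x = \<one>\<^bsub>G_star n\<^esub>"
  proof -
    obtain a where a: "a \<in> coprime_ints n" "x = ?c a"
      using x by (auto simp: carr)
    obtain b where b: "[a * b = 1] (mod int n)"
      using a cong_solve_coprime_int[of a "int n"] by (auto simp: coprime_ints_def)
    hence "coprime (a * b) (int n)"
      using cong_imp_coprime[OF cong_sym[OF b]] by simp
    hence b': "b \<in> coprime_ints n"
      by (simp add: coprime_ints_def)
    have "(b * a, 1) \<in> mod_star n"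
      using a b b' coprime_ints_mult coprime_ints_1
      by (auto simp: mod_star_def cong_iff_dvd_diff mult.commute)
    hence "?c (b * a) = ?c 1"
      using equiv_class_eq[OF equiv_mod_star] by metis
    thus ?thesis
      using a b' by (auto simp: simps)
  qed
  fix y assume y: "y \<in> carrier (G_star n)"
  show "x \<otimes>\<^bsub>G_star n\<^esub> y \<in> carrier (G_star n)"
    using x y by (auto simp: simps)
  show "x \<otimes>\<^bsub>G_star n\<^esub> y = y \<otimes>\<^bsub>G_star n\<^esub> x"
    using x y by (auto simp: simps mult.commute)
  fix z assume z: "z \<in> carrier (G_star n)"
  show "x \<otimes>\<^bsub>G_star n\<^esub> y \<otimes>\<^bsub>G_star n\<^esub> z = x \<otimes>\<^bsub>G_star n\<^esub> (y \<otimes>\<^bsub>G_star n\<^esub> z)"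
    using x y z by (auto simp: simps mult.assoc)
next
  show "\<one>\<^bsub>G_star n\<^esub> \<in> carrier (G_star n)"
    by (auto simp: G_star_def quotient_def coprime_ints_1)
qed

end

theory Submission
  imports Defs "HOL-Number_Theory.Residue_Primitive_Roots"
begin

text \<open>
  If the class of \<open>g\<close> generates, the units modulo \<open>n\<close> are \<open>\<plusminus>g\<^sup>k\<close>, whence \<open>\<phi>(n) \<le> 2 \<lambda>(n)\<close> for the
  Carmichael function \<open>\<lambda>\<close>. If \<open>n = u v\<close> with coprime \<open>u, v > 2\<close>, then \<open>\<lambda>(n)\<close> divides
  \<open>lcm (\<phi>(u)) (\<phi>(v))\<close>, which forces \<open>gcd (\<phi>(u)) (\<phi>(v)) = 2\<close>; a third coprime factor would even give
  \<open>\<lambda>(n) \<le> \<phi>(n) / 4\<close>.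

  Conversely, primitive roots settle prime powers. For \<open>n = u v\<close> with primitive roots \<open>g\<close> and \<open>h\<close>
  modulo \<open>u\<close> and \<open>v\<close>, one of \<open>\<phi>(u)/2\<close> and \<open>\<phi>(v)/2\<close> is odd, say the former, and the element
  congruent to \<open>g\<^sup>2\<close> modulo \<open>u\<close> and to \<open>h\<close> modulo \<open>v\<close> is a generator: as \<open>-1\<close> is not a square modulo \<open>u\<close>,
  any unit is up to sign an even power of \<open>g\<close> modulo \<open>u\<close>, and \<open>\<phi>(u)/2\<close> is coprime to \<open>\<phi>(v)\<close>, so the
  exponents modulo \<open>u\<close> and \<open>v\<close> can be matched simultaneously.
\<close>

section \<open>Classes, their powers, and cyclicity of \<open>G_star\<close>\<close>

lemma carrier_G_star: "carrier (G_star n) = (\<lambda>a. mod_star n `` {a}) ` coprime_ints n"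
  by (auto simp: G_star_def quotient_def)

lemma mod_star_class_eq_iff:
  assumes "a \<in> coprime_ints n" "b \<in> coprime_ints n"
  shows "mod_star n `` {a} = mod_star n `` {b} \<longleftrightarrow> (a, b) \<in> mod_star n"
  using eq_equiv_class_iff[OF equiv_mod_star assms] .

lemma coprime_ints_power: "a \<in> coprime_ints n \<Longrightarrow> a ^ k \<in> coprime_ints n"
  by (simp add: coprime_ints_def)

lemma mod_starI_cong:
  assumes "a \<in> coprime_ints n" "b \<in> coprime_ints n" "[a = b] (mod int n) \<or> [a = - b] (mod int n)"
  shows "(a, b) \<in> mod_star n"
  using assms by (auto simp: mod_star_def cong_iff_dvd_diff)

lemma G_star_pow_class:
  assumes "a \<in> coprime_ints n"
  shows "(mod_star n `` {a}) [^]\<^bsub>G_star n\<^esub> (k::nat) = mod_star n `` {a ^ k}"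
proof (induction k)
  case 0
  show ?case by (simp add: G_star_def)
next
  case (Suc k)
  interpret comm_group "G_star n" by (rule comm_group_G_star)
  show ?case
    using Suc G_star_mult_class[OF coprime_ints_power[OF assms] assms]
    by (simp add: mult.commute)
qed

text \<open>\<open>cyclic_group\<close> allows integer exponents. Once some positive power of
  \<open>x\<close> is trivial, each exponent can be replaced by its non-negative remainder, so
  natural exponents suffice.\<close>

lemma (in group) int_pow_eq_nat_pow_mod:
  assumes "x \<in> carrier G" "x [^] (m::nat) = \<one>" "m > 0"
  shows "x [^] (k::int) = x [^] nat (k mod int m)"
proof -
  have "x [^] k = x [^] (int m * (k div int m) + k mod int m)"
    by simp
  also have "\<dots> = (x [^] int m) [^] (k div int m) \<otimes> x [^] (k mod int m)"
    using assms(1) by (simp only: int_pow_mult int_pow_pow)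
  also have "x [^] int m = \<one>"
    using assms(2) by (simp add: int_pow_int)
  also have "x [^] (k mod int m) = x [^] nat (k mod int m)"
    using assms(3) by (metis int_pow_int nat_0_le of_nat_0_less_iff pos_mod_sign)
  finally show ?thesis
    using assms(1) by simp
qed

text \<open>This moves the question from the quotient group to congruences between integers. The
  generator and its exponents become natural numbers, to fit \<open>Carmichael\<close> and
  \<open>residue_primroot\<close>.\<close>

lemma cyclic_G_star_iff:
  assumes "n > 1"
  shows "cyclic_group (G_star n) \<longleftrightarrow>
    (\<exists>g::nat. coprime g n \<and> (\<forall>a\<in>coprime_ints n. \<exists>k. (int g ^ k, a) \<in> mod_star n))"
    (is "_ \<longleftrightarrow> ?R")
proof -
  interpret comm_group "G_star n" by (rule comm_group_G_star)
  show ?thesis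
  proof
    assume "cyclic_group (G_star n)"
    then obtain x where x: "x \<in> carrier (G_star n)"
      and gen: "carrier (G_star n) = range (\<lambda>k::int. x [^]\<^bsub>G_star n\<^esub> k)"
      using cyclic_group by auto
    obtain b where b: "b \<in> coprime_ints n" "x = mod_star n `` {b}"
      using x by (auto simp: carrier_G_star)
    \<comment> \<open>A natural number in the class of \<open>b\<close>, which itself may be
      negative.\<close>
    define g where "g = nat (b mod int n)"
    have int_g: "int g = b mod int n"
      using assms by (simp add: g_def)
    have cop: "coprime g n"
      using b(1) assms unfolding coprime_ints_def
      by (simp flip: coprime_int_iff add: int_g coprime_mod_left_iff)
    hence g: "int g \<in> coprime_ints n"
      by (simp add: coprime_ints_def)
    have xg: "x = mod_star n `` {int g}"
      unfolding b(2) mod_star_class_eq_iff[OF b(1) g]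
      by (intro mod_starI_cong b g) (simp add: int_g cong_def)
    \<comment> \<open>\<open>Carmichael n\<close> is the positive exponent annihilating
      \<open>x\<close> that \<open>int_pow_eq_nat_pow_mod\<close> asks for.\<close>
    have "[g ^ Carmichael n = 1] (mod n)"
      using assms cop by (intro power_Carmichael_eq_1) (auto simp: coprime_commute)
    hence "[int g ^ Carmichael n = 1] (mod int n)"
      by (metis cong_int_iff of_nat_1 of_nat_power)
    hence "x [^]\<^bsub>G_star n\<^esub> Carmichael n = mod_star n `` {1}"
      unfolding xg G_star_pow_class[OF g] mod_star_class_eq_iff[OF coprime_ints_power[OF g] coprime_ints_1]
      by (intro mod_starI_cong coprime_ints_power g coprime_ints_1) simp
    hence one: "x [^]\<^bsub>G_star n\<^esub> Carmichael n = \<one>\<^bsub>G_star n\<^esub>"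
      by (simp add: G_star_def)
    have "\<exists>k. (int g ^ k, a) \<in> mod_star n" if a: "a \<in> coprime_ints n" for a
    proof -
      have "mod_star n `` {a} \<in> range (\<lambda>k::int. x [^]\<^bsub>G_star n\<^esub> k)"
        using a gen carrier_G_star by blast
      then obtain k :: int where "mod_star n `` {a} = x [^]\<^bsub>G_star n\<^esub> k"
        by blast
      also have "\<dots> = mod_star n `` {int g ^ nat (k mod int (Carmichael n))}"
        using int_pow_eq_nat_pow_mod[OF x one Carmichael_pos] G_star_pow_class[OF g] xg by simp
      finally show ?thesis
        using mod_star_class_eq_iff[OF coprime_ints_power[OF g] a] by metis
    qed
    with cop show ?R by blast
  next
    assume ?R
    then obtain g :: nat where cop: "coprime g n"
      and gen: "\<And>a. a \<in> coprime_ints n \<Longrightarrow> \<exists>k. (int g ^ k, a) \<in> mod_star n" by blast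
    have g: "int g \<in> coprime_ints n"
      using cop by (simp add: coprime_ints_def)
    define x where "x = mod_star n `` {int g}"
    have x: "x \<in> carrier (G_star n)"
      using g by (simp add: x_def carrier_G_star)
    have "carrier (G_star n) \<subseteq> range (\<lambda>k::int. x [^]\<^bsub>G_star n\<^esub> k)"
    proof
      fix y assume "y \<in> carrier (G_star n)"
      then obtain a where a: "a \<in> coprime_ints n" "y = mod_star n `` {a}"
        by (auto simp: carrier_G_star)
      obtain k where "(int g ^ k, a) \<in> mod_star n"
        using gen a(1) by blast
      hence "y = mod_star n `` {int g ^ k}"
        using mod_star_class_eq_iff[OF coprime_ints_power[OF g] a(1)] a(2) by metis
      also have "\<dots> = x [^]\<^bsub>G_star n\<^esub> int k"
        by (simp add: x_def int_pow_int G_star_pow_class[OF g])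
      finally have "y = x [^]\<^bsub>G_star n\<^esub> int k" .
      thus "y \<in> range (\<lambda>k::int. x [^]\<^bsub>G_star n\<^esub> k)" by blast
    qed
    with x show "cyclic_group (G_star n)"
      unfolding cyclic_group by (intro bexI[of _ x]) auto
  qed
qed

section \<open>Necessity: comparing \<open>totient\<close> with \<open>Carmichael\<close>\<close>

text \<open>A counting argument: exponents of \<open>g\<close> matter only modulo
  \<open>Carmichael n\<close>, so the powers of \<open>g\<close> and their negatives give at most
  \<open>2 * Carmichael n\<close> residues, and these cover all totatives.\<close>

lemma totient_le_if_cyclic_G_star:
  assumes "n > 1" "cyclic_group (G_star n)"
  shows "totient n \<le> 2 * Carmichael n"
proof -
  let ?l = "Carmichael n"
  obtain g :: nat where cop: "coprime g n"
    and gen: "\<And>a. a \<in> coprime_ints n \<Longrightarrow> \<exists>k. (int g ^ k, a) \<in> mod_star n"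
    using assms cyclic_G_star_iff by blast
  have period: "[int g ^ k = int g ^ (k mod ?l)] (mod int n)" for k
  proof -
    have "[g ^ ?l = 1] (mod n)"
      using assms(1) cop by (intro power_Carmichael_eq_1) (auto simp: coprime_commute)
    hence "[int g ^ ?l = 1] (mod int n)"
      by (metis cong_int_iff of_nat_1 of_nat_power)
    hence "[(int g ^ ?l) ^ (k div ?l) * int g ^ (k mod ?l) = 1 ^ (k div ?l) * int g ^ (k mod ?l)] (mod int n)"
      by (intro cong_mult cong_pow cong_refl)
    thus ?thesis
      by (simp flip: power_mult power_add)
  qed
  have "int ` totatives n \<subseteq>
      (\<lambda>k. int g ^ k mod int n) ` {..<?l} \<union> (\<lambda>k. - (int g ^ k) mod int n) ` {..<?l}"
  proof
    fix a assume "a \<in> int ` totatives n"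
    then obtain m where m: "m \<in> totatives n" "a = int m" by blast
    have "m < n" using totatives_less[OF m(1)] assms(1) by simp
    have "a \<in> coprime_ints n"
      using m by (simp add: coprime_ints_def in_totatives_iff)
    then obtain k where "(int g ^ k, a) \<in> mod_star n" using gen by blast
    hence "[a = int g ^ k] (mod int n) \<or> [a = - (int g ^ k)] (mod int n)"
      by (auto simp: mod_star_def cong_iff_dvd_diff dvd_diff_commute add.commute)
    moreover have "[- (int g ^ k) = - (int g ^ (k mod ?l))] (mod int n)"
      using period[of k] by (simp add: cong_minus_minus_iff)
    ultimately have "[a = int g ^ (k mod ?l)] (mod int n) \<or> [a = - (int g ^ (k mod ?l))] (mod int n)"
      using period[of k] cong_trans by blast
    moreover have "a mod int n = a" using m \<open>m < n\<close> by simp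
    moreover have "k mod ?l \<in> {..<?l}" by simp
    ultimately show "a \<in> (\<lambda>k. int g ^ k mod int n) ` {..<?l} \<union> (\<lambda>k. - (int g ^ k) mod int n) ` {..<?l}"
      unfolding cong_def by (metis (no_types, lifting) UnI1 UnI2 image_eqI)
  qed
  hence "card (int ` totatives n) \<le>
      card ((\<lambda>k. int g ^ k mod int n) ` {..<?l} \<union> (\<lambda>k. - (int g ^ k) mod int n) ` {..<?l})"
    by (intro card_mono) auto
  also have "\<dots> \<le> card ((\<lambda>k. int g ^ k mod int n) ` {..<?l}) + card ((\<lambda>k. - (int g ^ k) mod int n) ` {..<?l})"
    by (rule card_Un_le)
  also have "\<dots> \<le> ?l + ?l"
    by (intro add_mono) (metis card_image_le card_lessThan finite_lessThan)+
  finally show ?thesis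
    by (simp add: card_image totient_def)
qed

lemma totient_times_le_twice_lcm_Carmichael:
  assumes "n > 1" "cyclic_group (G_star n)" "n = u * v" "coprime u v"
  shows "totient u * totient v \<le> 2 * lcm (Carmichael u) (Carmichael v)"
  using totient_le_if_cyclic_G_star[OF assms(1,2)] assms(3,4)
  by (simp add: totient_mult_coprime Carmichael_mult_coprime)

text \<open>As \<open>gcd a b * lcm a b = a * b\<close>, the positive factor \<open>lcm a b\<close>
  cancels.\<close>

lemma gcd_le_2_if_mult_le_twice_lcm:
  fixes a b :: nat
  assumes "a * b \<le> 2 * lcm a b" "a > 0" "b > 0"
  shows "gcd a b \<le> 2"
proof -
  have "gcd a b * lcm a b \<le> 2 * lcm a b"
    using assms(1) prod_gcd_lcm_nat[of a b] by metis
  moreover have "lcm a b > 0"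
    using assms by (simp add: lcm_pos_nat)
  ultimately show ?thesis
    by (metis mult_le_cancel2)
qed

text \<open>Replacing each Carmichael value by the totient that it divides turns the counting bound
  into an upper bound 2 for the gcd. Equality holds because totients of numbers above 2 are
  even.\<close>

lemma gcd_totient_if_cyclic_G_star:
  assumes "n > 1" "cyclic_group (G_star n)" "n = u * v" "coprime u v" "u > 2" "v > 2"
  shows "gcd (totient u) (totient v) = 2"
proof -
  have pos: "totient u > 0" "totient v > 0"
    using assms by auto
  have "lcm (Carmichael u) (Carmichael v) \<le> lcm (totient u) (totient v)"
    using pos by (intro dvd_imp_le lcm_mono Carmichael_dvd_totient) (auto simp: lcm_pos_nat)
  hence "totient u * totient v \<le> 2 * lcm (totient u) (totient v)"
    using totient_times_le_twice_lcm_Carmichael[OF assms(1-4)] by linarith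
  hence "gcd (totient u) (totient v) \<le> 2"
    using pos by (intro gcd_le_2_if_mult_le_twice_lcm)
  moreover have "2 dvd gcd (totient u) (totient v)"
    using assms(5,6) by (simp add: totient_even)
  moreover have "gcd (totient u) (totient v) > 0"
    using pos by simp
  ultimately show ?thesis
    by (metis dvd_imp_le le_antisym)
qed

text \<open>All three totients are even, so each of the two nested lcms saves a factor 2 over the
  product. The totient of \<open>n\<close> is then at least four times the lcm, while the counting
  bound allows only twice.\<close>

lemma not_cyclic_G_star_three_coprime_factors:
  assumes "n > 1" "n = u * (v * w)" "coprime u (v * w)" "coprime v w" "u > 2" "v > 2" "w > 2"
  shows "\<not> cyclic_group (G_star n)"
proof
  assume cyc: "cyclic_group (G_star n)"
  let ?a = "totient u" and ?b = "totient v" and ?c = "totient w"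
  obtain b' c' where b': "?b = 2 * b'" and c': "?c = 2 * c'"
    using totient_even assms(6,7) by (metis evenE)
  have pos: "?a > 0" "?b > 0" "?c > 0"
    using assms by auto
  have "Carmichael (v * w) dvd lcm ?b ?c"
    unfolding Carmichael_mult_coprime[OF assms(4)] by (intro lcm_mono Carmichael_dvd_totient)
  also have "lcm ?b ?c dvd 2 * (b' * c')"
    by (simp add: b' c')
  finally have "lcm (Carmichael u) (Carmichael (v * w)) dvd lcm ?a (2 * (b' * c'))"
    by (intro lcm_mono Carmichael_dvd_totient)
  \<comment> \<open>The second saving: \<open>?a\<close> and \<open>2 * (b' * c')\<close> share the
    factor 2.\<close>
  also have "even ?a"
    using totient_even assms(5) by blast
  hence "lcm ?a (2 * (b' * c')) dvd ?a * (b' * c')"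
    by (auto simp: elim!: evenE)
  finally have "lcm (Carmichael u) (Carmichael (v * w)) \<le> ?a * (b' * c')"
    by (rule dvd_imp_le) (use pos b' c' in auto)
  moreover have "?a * (?b * ?c) \<le> 2 * lcm (Carmichael u) (Carmichael (v * w))"
    using totient_times_le_twice_lcm_Carmichael[OF assms(1) cyc assms(2,3)] assms(4)
    by (simp add: totient_mult_coprime)
  moreover have "?a * (?b * ?c) = 4 * (?a * (b' * c'))"
    by (simp add: b' c')
  moreover have "?a * (b' * c') > 0"
    using pos b' c' by simp
  ultimately show False by linarith
qed

section \<open>Sufficiency: generators from primitive roots\<close>

lemma residue_primroot_power_cong:
  fixes a :: int
  assumes "m > 1" "residue_primroot m g" "coprime a (int m)"
  shows "\<exists>i. [int g ^ i = a] (mod int m)"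
proof -
  define b where "b = nat (a mod int m)"
  have int_b: "int b = a mod int m"
    using assms(1) by (simp add: b_def)
  have "coprime b m"
    using assms(1,3) by (simp flip: coprime_int_iff add: int_b coprime_mod_left_iff)
  moreover from this have "b > 0"
    using assms(1) by (intro Nat.gr0I) auto
  moreover have "b < m"
    using assms(1) int_b pos_mod_bound[of "int m" a] by linarith
  ultimately have "b \<in> totatives m"
    by (simp add: in_totatives_iff)
  then obtain i where "b = g ^ i mod m"
    using residue_primroot_is_generator[OF assms(1,2)] by (auto simp: bij_betw_def)
  hence "[int g ^ i = a] (mod int m)"
    using int_b unfolding cong_def by (metis of_nat_mod of_nat_power)
  thus ?thesis ..
qed

lemma cyclic_G_star_if_residue_primroot:
  assumes "n > 1" "residue_primroot n g"
  shows "cyclic_group (G_star n)"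
proof -
  have cop: "coprime g n"
    using assms(2) by (simp add: residue_primroot_def coprime_commute)
  have "\<exists>k. (int g ^ k, a) \<in> mod_star n" if a: "a \<in> coprime_ints n" for a
  proof -
    obtain k where "[int g ^ k = a] (mod int n)"
      using residue_primroot_power_cong[OF assms] a by (auto simp: coprime_ints_def)
    thus ?thesis
      using a cop by (intro exI mod_starI_cong) (auto simp: coprime_ints_def)
  qed
  thus ?thesis
    using cyclic_G_star_iff[OF assms(1)] cop by blast
qed

text \<open>Both \<open>a\<close> and \<open>- a\<close> are powers of \<open>g\<close>. If both
  exponents were odd, multiplying the two powers would make an even power of \<open>g\<close> the
  negative of another; raising to the odd exponent \<open>totient u div 2\<close> would give 1 = -1
  modulo \<open>u\<close>.\<close>

lemma residue_primroot_even_exponent_up_to_sign: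
  fixes a :: int
  assumes "u > 2" "residue_primroot u g" "odd (totient u div 2)" "coprime a (int u)"
  shows "\<exists>s\<in>{1, -1}. \<exists>i. [int g ^ (2 * i) = s * a] (mod int u)"
proof -
  let ?t = "totient u div 2"
  have u1: "u > 1" using assms(1) by simp
  have even: "2 * ?t = totient u"
    using totient_even[OF assms(1)] by simp
  obtain i where i: "[int g ^ i = a] (mod int u)"
    using residue_primroot_power_cong[OF u1 assms(2,4)] by blast
  obtain j where j: "[int g ^ j = - a] (mod int u)"
    using residue_primroot_power_cong[OF u1 assms(2), of "- a"] assms(4) by auto
  \<comment> \<open>Even powers of \<open>g\<close> become trivial under the exponent
    \<open>?t\<close>, because \<open>2 * ?t = totient u\<close>.\<close>
  have sq: "[(int g ^ (2 * k)) ^ ?t = 1] (mod int u)" for k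
  proof -
    have "[g ^ totient u = 1] (mod u)"
      using assms(2) by (intro euler_theorem) (auto simp: residue_primroot_def coprime_commute)
    hence "[int g ^ totient u = 1] (mod int u)"
      by (metis cong_int_iff of_nat_1 of_nat_power)
    hence "[(int g ^ totient u) ^ k = 1 ^ k] (mod int u)"
      by (rule cong_pow)
    moreover have "(int g ^ (2 * k)) ^ ?t = (int g ^ (2 * ?t)) ^ k"
      by (simp only: power_mult[symmetric] mult_ac)
    ultimately show ?thesis
      by (simp add: even)
  qed
  have "even i \<or> even j"
  proof (rule ccontr)
    assume "\<not> ?thesis"
    then obtain k where k: "i + j = 2 * k"
      by (metis evenE odd_even_add)
    have "[int g ^ i * int g ^ j = a * (- a)] (mod int u)"
      using i j by (rule cong_mult)
    also have "[a * (- a) = - (int g ^ i * int g ^ i)] (mod int u)"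
      using cong_mult[OF i i] by (simp add: cong_minus_minus_iff cong_sym_eq)
    finally have "[int g ^ (2 * k) = - (int g ^ (2 * i))] (mod int u)"
      by (simp only: k power_add[symmetric] mult_2[symmetric])
    hence "[(int g ^ (2 * k)) ^ ?t = (- (int g ^ (2 * i))) ^ ?t] (mod int u)"
      by (rule cong_pow)
    \<comment> \<open>Here the oddness of \<open>?t\<close> lets the minus sign survive.\<close>
    hence "[(int g ^ (2 * k)) ^ ?t = - ((int g ^ (2 * i)) ^ ?t)] (mod int u)"
      using assms(3) by simp
    moreover have "[- ((int g ^ (2 * i)) ^ ?t) = - 1] (mod int u)"
      using sq[of i] by (simp add: cong_minus_minus_iff)
    ultimately have "[1 = - 1] (mod int u)"
      using sq[of k] by (meson cong_sym cong_trans)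
    hence "int u dvd 2"
      by (simp add: cong_iff_dvd_diff)
    thus False
      using zdvd_imp_le[of "int u" 2] assms(1) by simp
  qed
  thus ?thesis
    using i j by (auto elim!: evenE)
qed

text \<open>Squaring \<open>g\<close> lowers its order to \<open>totient u div 2\<close>, which is
  coprime to the order of \<open>h\<close>; what is lost modulo \<open>u\<close> is recovered by the
  sign.\<close>

lemma cyclic_G_star_times:
  assumes "u > 2" "v > 2" "coprime u v" "residue_primroot u g" "residue_primroot v h"
    and gcd: "gcd (totient u) (totient v) = 2" and odd: "odd (totient u div 2)"
  shows "cyclic_group (G_star (u * v))"
proof -
  let ?t = "totient u div 2"
  have even: "2 * ?t = totient u" "even (totient v)"
    using totient_even assms(1,2) by auto
  have "coprime ?t (totient v)"
  proof -
    have "gcd ?t (totient v) dvd 2"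
      using gcd even(1) by (metis dvd_triv_right gcd_dvd1 gcd_dvd2 gcd_greatest dvd_trans)
    moreover have "gcd ?t (totient v) \<noteq> 2"
      using odd by (metis gcd_dvd1)
    ultimately show ?thesis
      by (metis coprime_iff_gcd_eq_1 two_is_prime_nat prime_nat_iff)
  qed
  have uv: "u * v > 1"
    using assms(1,2) by (metis One_nat_def less_1_mult less_trans one_less_numeral_iff semiring_norm(76))
  obtain x where x: "[x = g\<^sup>2] (mod u)" "[x = h] (mod v)"
    using binary_chinese_remainder_nat[OF assms(3)] by blast
  have "coprime x u" "coprime x v"
    using cong_imp_coprime[OF cong_sym[OF x(1)]] cong_imp_coprime[OF cong_sym[OF x(2)]] assms(4,5)
    by (auto simp: residue_primroot_def coprime_commute)
  hence cop: "coprime x (u * v)" by simp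
  have "\<exists>k. (int x ^ k, a) \<in> mod_star (u * v)" if a: "a \<in> coprime_ints (u * v)" for a
  proof -
    have au: "coprime a (int u)" and av: "coprime a (int v)"
      using a by (auto simp: coprime_ints_def)
    obtain s i where s: "s \<in> {1, -1}" and i: "[int g ^ (2 * i) = s * a] (mod int u)"
      using residue_primroot_even_exponent_up_to_sign[OF assms(1,4) odd au] by blast
    \<comment> \<open>The sign found modulo \<open>u\<close> must be used modulo \<open>v\<close> as
      well, since \<open>mod_star\<close> permits a single sign for the whole modulus;
      \<open>h\<close> reaches \<open>s * a\<close> for either sign.\<close>
    obtain j where j: "[int h ^ j = s * a] (mod int v)"
      using residue_primroot_power_cong[of v h "s * a"] assms(2,5) av s by auto
    obtain k where k: "[k = i] (mod ?t)" "[k = j] (mod totient v)"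
      using binary_chinese_remainder_nat[OF \<open>coprime ?t (totient v)\<close>] by blast
    \<comment> \<open>Doubling turns a congruence modulo \<open>?t\<close> into one modulo
      \<open>2 * ?t\<close>, so matching \<open>k\<close> with \<open>i\<close> modulo
      \<open>?t\<close> is enough for powers of \<open>g\<^sup>2\<close>.\<close>
    have "[2 * k = 2 * i] (mod totient u)"
      using k(1) even(1) by (metis cong_def mult_mod_right)
    hence "[g ^ (2 * k) = g ^ (2 * i)] (mod u)"
      using assms(4) by (subst order_divides_expdiff) (auto simp: residue_primroot_def)
    hence "[x ^ k = g ^ (2 * i)] (mod u)"
      using cong_pow[OF x(1), of k] by (metis cong_trans power_mult)
    hence "[int x ^ k = int g ^ (2 * i)] (mod int u)"
      by (metis cong_int_iff of_nat_power)
    hence cu: "[int x ^ k = s * a] (mod int u)"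
      using i by (rule cong_trans)
    have "[h ^ k = h ^ j] (mod v)"
      using k(2) assms(5) by (subst order_divides_expdiff) (auto simp: residue_primroot_def)
    hence "[x ^ k = h ^ j] (mod v)"
      using cong_pow[OF x(2), of k] by (metis cong_trans)
    hence "[int x ^ k = int h ^ j] (mod int v)"
      by (metis cong_int_iff of_nat_power)
    hence "[int x ^ k = s * a] (mod int v)"
      using j by (rule cong_trans)
    with cu have "[int x ^ k = s * a] (mod int (u * v))"
      using assms(3) by (simp add: coprime_cong_mult)
    thus ?thesis
      using a cop s by (intro exI mod_starI_cong coprime_ints_power) (auto simp: coprime_ints_def)
  qed
  thus ?thesis
    using cyclic_G_star_iff[OF uv] cop by blast
qed

section \<open>Splitting off prime powers, and the equivalence\<close>

text \<open>Meant to be applied to \<open>n\<close> and then to the cofactor, hence the oddness of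
  \<open>m\<close> in the conclusion. The bound \<open>p ^ a > 2\<close> ensures that the totient of
  \<open>p ^ a\<close> is even.\<close>

lemma extract_prime_power:
  fixes n :: nat
  assumes "n > 1" "odd n"
  obtains p a m where "prime p" "odd p" "a > 0" "n = p ^ a * m" "coprime (p ^ a) m" "m > 0" "odd m"
    "p ^ a > 2"
proof -
  obtain p where p: "prime p" "p dvd n"
    using prime_factor_nat[of n] assms(1) by auto
  obtain m where m: "n = p ^ multiplicity p n * m" "\<not> p dvd m"
    using multiplicity_decompose'[of n p] assms(1) p(1) not_prime_unit
    by (metis not_less_zero)
  have pos: "multiplicity p n > 0"
    using p assms(1) by (simp add: prime_multiplicity_gt_zero_iff)
  have "odd p"
    using p(2) assms(2) dvd_trans by blast
  moreover from this have "p > 2"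
    using prime_gt_1_nat[OF p(1)] by (metis One_nat_def Suc_lessI even_numeral numeral_2_eq_2)
  hence "p ^ multiplicity p n > 2"
    using pos self_le_power[of p "multiplicity p n"] by linarith
  moreover have "coprime (p ^ multiplicity p n) m"
    using p(1) m(2) by (simp add: prime_imp_coprime)
  moreover have "m > 0" "odd m"
    using m(2) assms(2) m(1) by (auto intro!: Nat.gr0I) (metis dvd_mult)
  ultimately show thesis
    using that p(1) pos m(1) by blast
qed

theorem theorem3:
  fixes n :: nat
  assumes "n > 1" and "odd n"
  shows "cyclic_group (G_star n) \<longleftrightarrow>
    (\<exists>p \<alpha> :: nat. prime p \<and> odd p \<and> \<alpha> > 0 \<and> n = p ^ \<alpha>) \<or>
    (\<exists>p q \<alpha> \<beta> :: nat. prime p \<and> odd p \<and> prime q \<and> odd q \<and> p \<noteq> q \<and> \<alpha> > 0 \<and> \<beta> > 0 \<and>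
       n = p ^ \<alpha> * q ^ \<beta> \<and> gcd (totient (p ^ \<alpha>)) (totient (q ^ \<beta>)) = 2)"
    (is "_ \<longleftrightarrow> ?one \<or> ?two")
proof
  assume cyc: "cyclic_group (G_star n)"
  obtain p a m where p: "prime p" "odd p" "a > 0" "n = p ^ a * m" "coprime (p ^ a) m" "m > 0" "odd m"
    "p ^ a > 2"
    using extract_prime_power[OF assms] .
  show "?one \<or> ?two"
  proof (cases "m = 1")
    case True
    thus ?thesis using p by auto
  next
    case False
    hence "m > 1" using p(6) by simp
    obtain q b k where q: "prime q" "odd q" "b > 0" "m = q ^ b * k" "coprime (q ^ b) k" "k > 0" "odd k"
      "q ^ b > 2"
      using extract_prime_power[OF \<open>m > 1\<close> p(7)] .
    \<comment> \<open>Otherwise \<open>k\<close>, being odd, exceeds 2, and \<open>n\<close> splits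
      into three pairwise coprime factors above 2.\<close>
    have "k = 1"
    proof (rule ccontr)
      assume "k \<noteq> 1"
      hence "k > 2"
        using q(6,7) by (cases "k = 2") auto
      with not_cyclic_G_star_three_coprime_factors[of n "p ^ a" "q ^ b" k] cyc assms(1) p q
      show False by simp
    qed
    hence m: "m = q ^ b" using q(4) by simp
    have "p \<noteq> q"
      using p(1,3,5) q(3) m by (auto simp: not_prime_unit)
    moreover have "gcd (totient (p ^ a)) (totient (q ^ b)) = 2"
      using gcd_totient_if_cyclic_G_star[OF assms(1) cyc p(4,5,8)] q(8) m by simp
    moreover have "n = p ^ a * q ^ b"
      using p(4) m by simp
    ultimately have ?two
      using p(1-3) q(1-3) by blast
    thus ?thesis ..
  qed
next
  assume "?one \<or> ?two"
  thus "cyclic_group (G_star n)"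
  proof
    assume ?one
    then obtain p a where p: "prime p" "odd p" "a > 0" "n = p ^ a" by blast
    obtain g where "\<forall>k>0. residue_primroot (p ^ k) g"
      using residue_primroot_odd_prime_power_exists[OF p(1,2)] .
    thus ?thesis
      using cyclic_G_star_if_residue_primroot assms(1) p by blast
  next
    assume ?two
    then obtain p q a b where p: "prime p" "odd p" "a > 0" and q: "prime q" "odd q" "b > 0"
      and "p \<noteq> q" and n: "n = p ^ a * q ^ b" and gcd: "gcd (totient (p ^ a)) (totient (q ^ b)) = 2"
      by blast
    let ?u = "p ^ a" and ?v = "q ^ b"
    have gt: "r ^ c > 2" if "prime r" "odd r" "c > 0" for r c :: nat
    proof -
      have "r > 2"
        using that by (metis even_numeral le_neq_implies_less prime_ge_2_nat)
      thus ?thesis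
        using self_le_power[of r c] that(3) by linarith
    qed
    have cop: "coprime ?u ?v"
      using p q \<open>p \<noteq> q\<close> by (simp add: primes_coprime)
    obtain g where g: "residue_primroot ?u g"
      using residue_primroot_odd_prime_power_exists[OF p(1,2)] p(3) by blast
    obtain h where h: "residue_primroot ?v h"
      using residue_primroot_odd_prime_power_exists[OF q(1,2)] q(3) by blast
    \<comment> \<open>If both halves were even, 4 would divide both totients and hence their gcd,
      which is 2.\<close>
    have "odd (totient ?u div 2) \<or> odd (totient ?v div 2)"
    proof (rule ccontr)
      assume "\<not> ?thesis"
      moreover have "even (totient ?u)" "even (totient ?v)"
        using totient_even gt p q by blast+
      ultimately have "4 dvd totient ?u" "4 dvd totient ?v"
        by presburger+
      hence "4 dvd gcd (totient ?u) (totient ?v)" by simp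
      thus False using gcd by simp
    qed
    thus ?thesis
    proof
      assume "odd (totient ?u div 2)"
      thus ?thesis
        using cyclic_G_star_times[OF gt[OF p] gt[OF q] cop g h gcd] n by simp
    next
      assume "odd (totient ?v div 2)"
      \<comment> \<open>The two prime powers exchange roles, so that the squared primitive root is
        now the one modulo \<open>?v\<close>.\<close>
      thus ?thesis
        using cyclic_G_star_times[OF gt[OF q] gt[OF p] _ h g] cop gcd n
        by (simp add: coprime_commute gcd.commute mult.commute)
    qed
  qed
qed

end
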